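(* Assume $Y$ is an $r$-set, $Y=Y_1\times\dots\times Y_r\times Y_0$. Let $f\in L_2(X)$ and let $g_1^0,\dots,g_r^0:\mathbb{R}\to\mathbb{R}$ be such that $w_i(\mathbf{x})g_i^0(\mathbf{a}^i\cdot\mathbf{x})\in L_2(X)$, $i=1,\dots,r$; assume that for each $j$ and a.e. $y_j\in Y_j$ the quantity $\int_{Y^{(j)}}w_j^{*}(\mathbf{y})^2\,d\mathbf{y}^{(j)}$ is finite and positive. Then $\sum_{i=1}^r w_i(\mathbf{x})g_i^0(\mathbf{a}^i\cdot\mathbf{x})$ is a best $L_2(X)$ approximation to $f$ from $\mathcal{R}(\mathbf{a}^1,\dots,\mathbf{a}^r;w_1,\dots,w_r)$ if and only if, for each $j=1,\dots,r$ and a.e. $y_j\in Y_j$, $$g_j^0(y_j)=\frac{1}{\int_{Y^{(j)}}w_j^{*}(\mathbf{y})^2\,d\mathbf{y}^{(j)}}\int_{Y^{(j)}}\Big(f^*(\mathbf{y})-\sum_{i=1,\,i\ne j}^r w_i^*(\mathbf{y})g_i^0(y_i)\Big)w_j^*(\mathbf{y})\,d\mathbf{y}^{(j)}.$$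
   Context: Let $X\subset\mathbb{R}^n$ have finite Lebesgue measure, let $r\le n$, and let $\mathbf{a}^1,\dots,\mathbf{a}^r\in\mathbb{R}^n$ be linearly independent; complete them to a basis $\mathbf{a}^1,\dots,\mathbf{a}^n$ of $\mathbb{R}^n$. Let $J$ be the linear map $y_i=\mathbf{a}^i\cdot\mathbf{x}$, $i=1,\dots,n$, with inverse $x_i=\mathbf{b}^i\cdot\mathbf{y}$; set $Y=J(X)$ and $Y_i=\{\mathbf{a}^i\cdot\mathbf{x}:\mathbf{x}\in X\}\subset\mathbb{R}$. For a function $u$ on $X$ put $u^*(\mathbf{y})=u(\mathbf{b}^1\cdot\mathbf{y},\dots,\mathbf{b}^n\cdot\mathbf{y})$. $Y$ is called an $r$-set if $Y=Y_1\times\dots\times Y_r\times Y_0$ for some (measurable) $Y_0\subset\mathbb{R}^{n-r}$ (coordinates $y_{r+1},\dots,y_n$). For $j=1,\dots,r$, $Y^{(j)}=Y_1\times\dots\times Y_{j-1}\times Y_{j+1}\times\dots\times Y_r\times Y_0$, and $\int_{Y^{(j)}}\cdots\,d\mathbf{y}^{(j)}$ denotes integration over all coordinates of $\mathbf{y}$ except $y_j$, with $y_j$ held fixed. Fixed weight functions $w_1,\dots,w_r\in L_2(X)$ are given, and $\mathcal{R}(\mathbf{a}^1,\dots,\mathbf{a}^r;w_1,\dots,w_r)$ is the set of functions $\sum_{i=1}^r w_i(\mathbf{x})g_i(\mathbf{a}^i\cdot\mathbf{x})$ with $g_i:\mathbb{R}\to\mathbb{R}$ such that each $w_i(\mathbf{x})g_i(\mathbf{a}^i\cdot\mathbf{x})\in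 L_2(X)$. A best approximation is an element minimizing $\|f-g\|_{L_2(X)}$ over this set. *)

theory Defs
  imports "HOL-Analysis.Analysis"
begin

definition L2 :: "(real^'n) set \<Rightarrow> (real^'n \<Rightarrow> real) \<Rightarrow> bool" where
  "L2 X u \<longleftrightarrow> u \<in> borel_measurable (lebesgue_on X) \<and> integrable (lebesgue_on X) (\<lambda>x. (u x)^2)"

definition L2_dist :: "(real^'n) set \<Rightarrow> (real^'n \<Rightarrow> real) \<Rightarrow> (real^'n \<Rightarrow> real) \<Rightarrow> real" where
  "L2_dist X u v = sqrt (\<integral>x. (u x - v x)^2 \<partial>lebesgue_on X)"

text \<open>The set R(a^i, i in I; w_i, i in I); I is the set of the r distinguished indices.\<close>
definition ridge_set ::
  "(real^'n) set \<Rightarrow> 'n set \<Rightarrow> ('n \<Rightarrow> real^'n) \<Rightarrow> ('n \<Rightarrow> real^'n \<Rightarrow> real) \<Rightarrow> (real^'n \<Rightarrow> real) set" where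
  "ridge_set X I a w = {h. \<exists>g :: 'n \<Rightarrow> real \<Rightarrow> real.
      (\<forall>i\<in>I. L2 X (\<lambda>x. w i x * g i (a i \<bullet> x))) \<and> h = (\<lambda>x. \<Sum>i\<in>I. w i x * g i (a i \<bullet> x))}"

definition best_approx :: "(real^'n) set \<Rightarrow> (real^'n \<Rightarrow> real) set \<Rightarrow> (real^'n \<Rightarrow> real) \<Rightarrow> (real^'n \<Rightarrow> real) \<Rightarrow> bool" where
  "best_approx X R f h \<longleftrightarrow> h \<in> R \<and> (\<forall>h'\<in>R. L2_dist X f h \<le> L2_dist X f h')"

definition Jmat :: "('n \<Rightarrow> real^'n) \<Rightarrow> real^'n^'n" where
  "Jmat a = (\<chi> i. a i)"

definition ustar :: "('n::finite \<Rightarrow> real^'n) \<Rightarrow> (real^'n \<Rightarrow> real) \<Rightarrow> real^'n \<Rightarrow> real" where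
  "ustar a u y = u (matrix_inv (Jmat a) *v y)"

definition proj_set :: "(real^'n) set \<Rightarrow> ('n \<Rightarrow> real^'n) \<Rightarrow> 'n \<Rightarrow> real set" where
  "proj_set X a i = (\<lambda>x. a i \<bullet> x) ` X"

definition ext :: "'n::finite \<Rightarrow> real \<Rightarrow> ('n \<Rightarrow> real) \<Rightarrow> real^'n" where
  "ext j t z = (\<chi> k. if k = j then t else z k)"

text \<open>Y^(j) = prod_{k in I-{j}} Y_k x Y_0, as a set of coordinate functions on UNIV - {j}.\<close>
definition fibre_set :: "'n set \<Rightarrow> ('n \<Rightarrow> real set) \<Rightarrow> ('n \<Rightarrow> real) set \<Rightarrow> 'n \<Rightarrow> ('n \<Rightarrow> real) set" where
  "fibre_set I Ys Y0 j = {z. (\<forall>k\<in>I - {j}. z k \<in> Ys k) \<and> restrict z (- I) \<in> Y0}"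

definition Mfib :: "'n::finite \<Rightarrow> ('n \<Rightarrow> real) measure" where
  "Mfib j = completion (PiM (UNIV - {j}) (\<lambda>_. lborel))"

end

theory Submission
  imports Defs
begin

text \<open>
  The proof has three ingredients.
  (1) Orthogonality: a function h in a set R of L2 functions that is closed under adding
      multiples of the elements of a generating family V is a best approximation to f
      iff the residual f - h is orthogonal to V.  For the ridge set the generators are the
      single ridge components w_j(x) g(a^j . x), so best approximation means that the
      residual is orthogonal to every admissible component, separately for each j.
  (2) Slicing: the substitution y = J x turns Lebesgue measure into a constant multiple
      of itself (proved for an arbitrary invertible linear map of real^'n), and Fubini
      along the coordinate y_j writes an integral over X as k times an integral over t
      of an integral over the remaining coordinates z.  The r-set hypothesis factors the
      indicator of J X at the point (t, z) into indicators of Y_j and Y^(j).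
  (3) Normal equations: orthogonality to all w_j g(a^j . x) is equivalent to the a.e.
      vanishing on Y_j of the fibre moment E_j(t) of the residual against w_j* (testing
      with truncations of E_j itself), and solving E_j(t) = 0 for g0_j(t), using that
      the fibre mass of w_j* is finite and positive, gives exactly the stated formula.
\<close>

section \<open>Invertible linear maps rescale Lebesgue measure\<close>

definition scales_lebesgue :: "(real^'n::finite \<Rightarrow> real^'n) \<Rightarrow> real \<Rightarrow> bool" where
  "scales_lebesgue f c \<longleftrightarrow>
     (\<forall>S\<in>lmeasurable. f ` S \<in> lmeasurable \<and> measure lebesgue (f ` S) = c * measure lebesgue S)"

lemma scales_lebesgue_comp:
  assumes "scales_lebesgue f cf" "scales_lebesgue g cg"
  shows "scales_lebesgue (f \<circ> g) (cf * cg)"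
  using assms unfolding scales_lebesgue_def image_comp[symmetric] by (simp del: image_image)

lemma scales_lebesgue_singular:
  fixes f :: "real^'n::finite \<Rightarrow> real^'n"
  assumes "linear f" "\<not> inj f"
  shows "scales_lebesgue f 0"
  unfolding scales_lebesgue_def
proof (intro ballI conjI)
  fix S :: "(real^'n) set"
  have neg: "negligible (f ` S)" by (rule negligible_linear_singular_image[OF assms])
  then show "f ` S \<in> lmeasurable"
    using lmeasurable_iff_indicator_has_integral negligible_UNIV assms negligible_linear_singular_image by blast
  show "measure lebesgue (f ` S) = 0 * measure lebesgue S"
    using neg negligible_imp_measure0 by simp
qed

lemma scales_lebesgue_stretch:
  "scales_lebesgue (\<lambda>x::real^'n::finite. \<chi> i. c i * x $ i) \<bar>prod c UNIV\<bar>"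
  by (simp add: scales_lebesgue_def measurable_stretch measure_stretch)

lemma scales_lebesgue_if_boxes:
  fixes h :: "real^'n::finite \<Rightarrow> real^'n"
  assumes lin: "linear h" and box: "\<And>a b. measure lebesgue (h ` cbox a b) = measure lebesgue (cbox a b)"
  shows "scales_lebesgue h 1"
  unfolding scales_lebesgue_def
proof
  fix S :: "(real^'n) set" assume S: "S \<in> lmeasurable"
  have "h ` S \<in> lmeasurable \<and> 1 * measure lebesgue S = measure lebesgue (h ` S)"
    by (rule measure_linear_sufficient[OF lin S]) (simp add: box)
  then show "h ` S \<in> lmeasurable \<and> measure lebesgue (h ` S) = 1 * measure lebesgue S" by simp
qed

lemma measure_swap_cbox:
  fixes a b :: "real^'n::finite"
  shows "measure lebesgue ((\<lambda>v. \<chi> i. v $ Transposition.transpose m n i) ` cbox a b) = measure lebesgue (cbox a b)"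
proof (cases "cbox a b = {}")
  case False
  let ?h = "\<lambda>v::real^'n. \<chi> i. v $ Transposition.transpose m n i"
  have eq: "?h ` (cbox a b) = cbox (?h a) (?h b)"
    by (auto simp: image_iff lambda_swap_Galois mem_box_cart) (metis transpose_involutory)+
  have "?h ` (cbox a b) \<noteq> {}" using False by blast
  then show ?thesis
    using prod.permute [OF permutes_swap_id, where S=UNIV and g="\<lambda>i. (b - a)$i", symmetric]
    by (simp add: eq content_cbox_cart False)
qed simp

text \<open>The library computes the volume of a sheared box only for boxes with a nonnegative corner;
  a translation removes this restriction.\<close>
lemma measure_shear_cbox:
  fixes a b :: "real^'n::finite"
  assumes "m \<noteq> n"
  shows "measure lebesgue ((\<lambda>v. \<chi> i. if i = m then v $ m + v $ n else v $ i) ` cbox a b) = measure lebesgue (cbox a b)"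
proof (cases "cbox a b = {}")
  case False
  let ?h = "\<lambda>v::real^'n. \<chi> i. if i = m then v $ m + v $ n else v $ i"
  let ?v = "\<chi> i. if i = n then - a $ n else 0"
  have ne: "(+) ?v ` cbox a b \<noteq> {}" using False by auto
  have "?h ` cbox a b = (+) (\<chi> i. if i = m \<or> i = n then a $ n else 0) ` ?h ` (+) ?v ` (cbox a b)"
    using \<open>m \<noteq> n\<close> unfolding image_comp o_def by (force simp: vec_eq_iff)
  then have "measure lebesgue (?h ` (cbox a b)) = measure lebesgue (?h ` (+) ?v ` cbox a b)"
    by (rule ssubst) (rule measure_translation)
  also have "\<dots> = measure lebesgue (?h ` cbox (?v + a) (?v + b))"
    by (metis (no_types, lifting) cbox_translation)
  also have "\<dots> = measure lebesgue ((+) ?v ` cbox a b)"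
    apply (subst measure_shear_interval)
    using \<open>m \<noteq> n\<close> ne apply auto
     apply (simp add: cbox_translation)
    by (metis cbox_borel cbox_translation measure_completion sets_lborel)
  also have "\<dots> = measure lebesgue (cbox a b)"
    by (rule measure_translation)
  finally show ?thesis .
qed simp

text \<open>The library proves
  this (with the constant being the determinant) only for index types that are well-ordered;
  the factorisation into elementary maps works for any finite index type.\<close>
lemma linear_scales_lebesgue:
  fixes f :: "real^'n::finite \<Rightarrow> real^'n"
  assumes "linear f"
  shows "\<exists>c\<ge>0. scales_lebesgue f c"
proof (rule induct_linear_elementary[OF assms])
  fix f g :: "real^'n \<Rightarrow> real^'n"
  assume "\<exists>c\<ge>0. scales_lebesgue f c" "\<exists>c\<ge>0. scales_lebesgue g c"
  then obtain cf cg where "cf \<ge> 0" "scales_lebesgue f cf" "cg \<ge> 0" "scales_lebesgue g cg"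
    by blast
  then show "\<exists>c\<ge>0. scales_lebesgue (f \<circ> g) c"
    using scales_lebesgue_comp by (intro exI[of _ "cf * cg"]) simp
next
  fix f :: "real^'n \<Rightarrow> real^'n" and i
  assume "linear f" and "\<And>x. f x $ i = 0"
  then have "\<not> inj f"
    by (metis (full_types) linear_injective_imp_surjective one_neq_zero surjE vec_component)
  then show "\<exists>c\<ge>0. scales_lebesgue f c"
    using scales_lebesgue_singular[OF \<open>linear f\<close>] by (intro exI[of _ 0]) simp
next
  fix c :: "'n \<Rightarrow> real"
  show "\<exists>d\<ge>0. scales_lebesgue (\<lambda>x. \<chi> i. c i * x $ i) d"
    using scales_lebesgue_stretch by (intro exI[of _ "\<bar>prod c UNIV\<bar>"]) simp
next
  fix m n :: 'n
  have "linear (\<lambda>v::real^'n. \<chi> i. v $ Transposition.transpose m n i)"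
    by (rule linearI) (simp_all add: plus_vec_def scaleR_vec_def)
  then have "scales_lebesgue (\<lambda>v. \<chi> i. v $ Transposition.transpose m n i) 1"
    by (rule scales_lebesgue_if_boxes) (rule measure_swap_cbox)
  then show "\<exists>c\<ge>0. scales_lebesgue (\<lambda>v. \<chi> i. v $ Transposition.transpose m n i) c"
    by (intro exI[of _ 1]) simp
next
  fix m n :: 'n
  assume "m \<noteq> n"
  have "linear (\<lambda>v::real^'n. \<chi> i. if i = m then v $ m + v $ n else v $ i)"
    by (rule linearI) (auto simp: algebra_simps plus_vec_def scaleR_vec_def vec_eq_iff)
  then have "scales_lebesgue (\<lambda>v. \<chi> i. if i = m then v $ m + v $ n else v $ i) 1"
    by (rule scales_lebesgue_if_boxes) (rule measure_shear_cbox[OF \<open>m \<noteq> n\<close>])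
  then show "\<exists>c\<ge>0. scales_lebesgue (\<lambda>v. \<chi> i. if i = m then v $ m + v $ n else v $ i) c"
    by (intro exI[of _ 1]) simp
qed

text \<open>Scaling extends from sets of finite measure to all Lebesgue measurable sets, by exhausting
  a set with its intersections with balls.\<close>
lemma scales_lebesgue_emeasure:
  assumes sc: "scales_lebesgue f c" and c: "c \<ge> 0" and A: "A \<in> sets lebesgue"
  shows "f ` A \<in> sets lebesgue \<and> emeasure lebesgue (f ` A) = ennreal c * emeasure lebesgue A"
proof -
  define B where "B n = A \<inter> cball 0 (real n)" for n :: nat
  have Bm: "B n \<in> lmeasurable" for n
    unfolding B_def by (rule bounded_set_imp_lmeasurable) (auto intro: A bounded_Int)
  have fB: "f ` B n \<in> lmeasurable" "measure lebesgue (f ` B n) = c * measure lebesgue (B n)" for n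
    using sc Bm unfolding scales_lebesgue_def by auto
  have UB: "(\<Union>n. B n) = A"
    by (auto simp: B_def) (meson mem_cball_0 real_arch_simple)
  then have fUB: "(\<Union>n. f ` B n) = f ` A" by blast
  have incB: "incseq B" by (auto simp: incseq_def B_def)
  then have incfB: "incseq (\<lambda>n. f ` B n)" by (auto simp: incseq_def)
  have "f ` A \<in> sets lebesgue"
    unfolding fUB[symmetric] using fB by (intro sets.countable_UN') auto
  moreover have "emeasure lebesgue (f ` A) = (SUP n. emeasure lebesgue (f ` B n))"
    unfolding fUB[symmetric] by (rule SUP_emeasure_incseq[symmetric]) (use fB incfB in auto)
  moreover have "\<dots> = (SUP n. ennreal c * emeasure lebesgue (B n))"
    using fB Bm by (intro SUP_cong refl) (simp add: emeasure_eq_measure2 ennreal_mult c)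
  moreover have "\<dots> = ennreal c * (SUP n. emeasure lebesgue (B n))"
    by (rule SUP_mult_left_ennreal[symmetric])
  moreover have "(SUP n. emeasure lebesgue (B n)) = emeasure lebesgue A"
    unfolding UB[symmetric] by (rule SUP_emeasure_incseq) (use Bm incB in auto)
  ultimately show ?thesis by simp
qed

lemma distr_lebesgue_linear_bij:
  fixes L :: "real^'n::finite \<Rightarrow> real^'n"
  assumes lin: "linear L" "linear L'" and inv: "\<And>x. L' (L x) = x" "\<And>y. L (L' y) = y"
  shows "\<exists>k>0. L \<in> lebesgue \<rightarrow>\<^sub>M lebesgue \<and> distr lebesgue lebesgue L = density lebesgue (\<lambda>_. ennreal k)"
proof -
  obtain c where c0: "c \<ge> 0" and c: "scales_lebesgue L' c"
    using linear_scales_lebesgue[OF lin(2)] by blast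
  have "L' ` (L ` cbox 0 One) = cbox 0 One"
    using inv by (force simp: image_comp)
  then have "measure lebesgue (cbox 0 (One::real^'n)) = c * measure lebesgue (L ` cbox 0 One)"
    using c measurable_linear_image_interval[OF lin(1)] unfolding scales_lebesgue_def by metis
  moreover have "measure lebesgue (cbox 0 (One::real^'n)) = 1"
    by (metis cbox_borel content_unit measure_completion sets_lborel measure_lborel_cbox_eq)
  ultimately have "c \<noteq> 0" by auto
  with c0 have cpos: "c > 0" by simp
  have pre: "L -` A \<inter> space lebesgue = L' ` A" for A
    using inv by (auto simp: image_iff) metis
  have meas: "L \<in> lebesgue \<rightarrow>\<^sub>M lebesgue"
  proof (rule measurableI)
    fix A :: "(real^'n) set" assume "A \<in> sets lebesgue"
    then show "L -` A \<inter> space lebesgue \<in> sets lebesgue"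
      unfolding pre using scales_lebesgue_emeasure[OF c c0] by blast
  qed simp
  have "distr lebesgue lebesgue L = density lebesgue (\<lambda>_. ennreal c)"
  proof (rule measure_eqI)
    fix A assume "A \<in> sets (distr lebesgue lebesgue L)"
    then have A: "A \<in> sets lebesgue" by simp
    show "emeasure (distr lebesgue lebesgue L) A = emeasure (density lebesgue (\<lambda>_. ennreal c)) A"
      using A meas scales_lebesgue_emeasure[OF c c0 A] pre[of A]
      by (simp add: emeasure_distr emeasure_density_const del: emeasure_completion)
  qed simp
  with meas cpos show ?thesis by blast
qed

locale linear_change =
  fixes J T :: "real^'n::finite \<Rightarrow> real^'n" and k :: real
  assumes TJ: "\<And>x. T (J x) = x" and JT: "\<And>y. J (T y) = y"
    and J_meas: "J \<in> lebesgue \<rightarrow>\<^sub>M lebesgue" and T_meas: "T \<in> lebesgue \<rightarrow>\<^sub>M lebesgue"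
    and distr_J: "distr lebesgue lebesgue J = density lebesgue (\<lambda>_. ennreal k)" and k_pos: "k > 0"
begin

lemma indicator_image_T: "indicator (J ` X) y = (indicator X (T y) :: 'b::zero_neq_one)"
proof -
  have "T y \<in> X \<longleftrightarrow> y \<in> J ` X"
    by (metis JT TJ image_iff)
  then show ?thesis by (simp add: indicator_def)
qed

lemma indicator_image_J: "indicator (J ` X) (J x) = (indicator X x :: 'b::zero_neq_one)"
  by (simp add: indicator_image_T TJ)

lemma transformed_measurable:
  fixes v :: "real^'n \<Rightarrow> real"
  assumes X: "X \<in> sets lebesgue" and v: "v \<in> borel_measurable (lebesgue_on X)"
  shows "(\<lambda>y. indicator (J ` X) y * v (T y)) \<in> borel_measurable lebesgue"
proof -
  have "(\<lambda>x. indicator X x *\<^sub>R v x) \<in> borel_measurable lebesgue"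
    using v X by (subst (asm) borel_measurable_restrict_space_iff) auto
  from measurable_compose[OF T_meas this] show ?thesis by (simp add: indicator_image_T)
qed

lemma nn_integral_transform:
  fixes v :: "real^'n \<Rightarrow> real"
  assumes X: "X \<in> sets lebesgue" and v: "v \<in> borel_measurable (lebesgue_on X)"
  shows "(\<integral>\<^sup>+x. ennreal (v x) \<partial>lebesgue_on X) = ennreal k * (\<integral>\<^sup>+y. ennreal (indicator (J ` X) y * v (T y)) \<partial>lebesgue)"
proof -
  have m: "(\<lambda>y. ennreal (indicator (J ` X) y * v (T y))) \<in> borel_measurable lebesgue"
    using transformed_measurable[OF X v] by simp
  have "(\<integral>\<^sup>+x. ennreal (v x) \<partial>lebesgue_on X) = (\<integral>\<^sup>+x. ennreal (v x) * indicator X x \<partial>lebesgue)"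
    using X by (subst nn_integral_restrict_space) auto
  also have "\<dots> = (\<integral>\<^sup>+x. ennreal (indicator (J ` X) (J x) * v (T (J x))) \<partial>lebesgue)"
    by (intro nn_integral_cong) (simp add: indicator_image_J TJ split: split_indicator)
  also have "\<dots> = (\<integral>\<^sup>+y. ennreal (indicator (J ` X) y * v (T y)) \<partial>distr lebesgue lebesgue J)"
    using J_meas m by (simp add: nn_integral_distr)
  also have "\<dots> = (\<integral>\<^sup>+y. ennreal k * ennreal (indicator (J ` X) y * v (T y)) \<partial>lebesgue)"
    unfolding distr_J by (rule nn_integral_density) (use m in auto)
  also have "\<dots> = ennreal k * (\<integral>\<^sup>+y. ennreal (indicator (J ` X) y * v (T y)) \<partial>lebesgue)"
    by (rule nn_integral_cmult) (use m in auto)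
  finally show ?thesis .
qed

lemma integral_transform:
  fixes v :: "real^'n \<Rightarrow> real"
  assumes X: "X \<in> sets lebesgue" and v: "integrable (lebesgue_on X) v"
  shows "integrable lebesgue (\<lambda>y. indicator (J ` X) y * v (T y))"
    and "(\<integral>x. v x \<partial>lebesgue_on X) = k * (\<integral>y. indicator (J ` X) y * v (T y) \<partial>lebesgue)"
proof -
  let ?v = "\<lambda>y. indicator (J ` X) y * v (T y)"
  have m: "?v \<in> borel_measurable lebesgue"
    using transformed_measurable[OF X] v by auto
  have eq: "(\<lambda>x. indicator X x *\<^sub>R v x) = (\<lambda>x. ?v (J x))"
    by (simp add: indicator_image_J TJ)
  have "integrable lebesgue (\<lambda>x. ?v (J x))"
    using v X eq by (subst (asm) integrable_restrict_space) auto
  then have "integrable (distr lebesgue lebesgue J) ?v"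
    by (subst integrable_distr_eq[OF J_meas m])
  then have "integrable lebesgue (\<lambda>y. (1/k) * (k * ?v y))"
    unfolding distr_J by (subst (asm) integrable_density) (use m k_pos in auto)
  then show "integrable lebesgue ?v" using k_pos by simp
  have "(\<integral>x. v x \<partial>lebesgue_on X) = (\<integral>x. ?v (J x) \<partial>lebesgue)"
    using X by (subst integral_restrict_space) (auto simp only: eq)
  also have "\<dots> = (\<integral>y. ?v y \<partial>distr lebesgue lebesgue J)"
    by (rule integral_distr[symmetric, OF J_meas m])
  also have "\<dots> = k * (\<integral>y. ?v y \<partial>lebesgue)"
    unfolding distr_J by (subst integral_density) (use m k_pos in auto)
  finally show "(\<integral>x. v x \<partial>lebesgue_on X) = k * (\<integral>y. ?v y \<partial>lebesgue)" .
qed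

end

lemma linear_change_Jmat:
  fixes a :: "'n::finite \<Rightarrow> real^'n"
  assumes inv: "invertible (Jmat a)"
  shows "\<exists>k. linear_change (\<lambda>x. Jmat a *v x) (\<lambda>y. matrix_inv (Jmat a) *v y) k"
proof -
  have mi: "Jmat a ** matrix_inv (Jmat a) = mat 1 \<and> matrix_inv (Jmat a) ** Jmat a = mat 1"
    using inv unfolding invertible_def matrix_inv_def by (rule someI_ex)
  then have TJ: "matrix_inv (Jmat a) *v (Jmat a *v x) = x"
    and JT: "Jmat a *v (matrix_inv (Jmat a) *v y) = y" for x y
    by (simp_all add: matrix_vector_mul_assoc)
  obtain k where "k > 0" "(\<lambda>x. Jmat a *v x) \<in> lebesgue \<rightarrow>\<^sub>M lebesgue"
    "distr lebesgue lebesgue (\<lambda>x. Jmat a *v x) = density lebesgue (\<lambda>_. ennreal k)"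
    using distr_lebesgue_linear_bij[of "\<lambda>x. Jmat a *v x" "\<lambda>y. matrix_inv (Jmat a) *v y"] TJ JT by auto
  moreover have "(\<lambda>y. matrix_inv (Jmat a) *v y) \<in> lebesgue \<rightarrow>\<^sub>M lebesgue"
    using distr_lebesgue_linear_bij[of "\<lambda>y. matrix_inv (Jmat a) *v y" "\<lambda>x. Jmat a *v x"] TJ JT by auto
  ultimately show ?thesis
    by (intro exI[of _ k], unfold_locales) (use TJ JT in auto)
qed

section \<open>Slicing real^'n along one coordinate\<close>

definition slice_measure :: "'n::finite \<Rightarrow> (real \<times> ('n \<Rightarrow> real)) measure" where
  "slice_measure j = lborel \<Otimes>\<^sub>M PiM (UNIV - {j}) (\<lambda>_. lborel)"

lemma ext_nth: "ext j t z $ i = (if i = j then t else z i)"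
  by (simp add: ext_def)

lemma ext_measurable[measurable]:
  "(\<lambda>p. ext j (fst p) (snd p)) \<in> slice_measure j \<rightarrow>\<^sub>M (borel :: (real^'n::finite) measure)"
proof (subst borel_measurable_euclidean_space, intro ballI)
  fix b :: "real^'n" assume "b \<in> Basis"
  then obtain i where b: "b = axis i 1" using axis_inverse[of b] by auto
  have "(\<lambda>p. ext j (fst p) (snd p) \<bullet> b) = (\<lambda>p. if i = j then fst p else snd p i)"
    by (auto simp: b cart_eq_inner_axis[symmetric] ext_nth)
  moreover have "(\<lambda>p. if i = j then fst p else snd p i) \<in> borel_measurable (slice_measure j)"
  proof (cases "i = j")
    case True
    have "fst \<in> slice_measure j \<rightarrow>\<^sub>M lborel" unfolding slice_measure_def by (rule measurable_fst)
    then show ?thesis using True by (simp add: measurable_lborel2)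
  next
    case False
    have "(\<lambda>p. snd p i) \<in> slice_measure j \<rightarrow>\<^sub>M lborel" unfolding slice_measure_def
      by (rule measurable_compose[OF measurable_snd measurable_component_singleton]) (use False in simp)
    then show ?thesis using False by (simp add: measurable_lborel2)
  qed
  ultimately show "(\<lambda>p. ext j (fst p) (snd p) \<bullet> b) \<in> borel_measurable (slice_measure j)" by simp
qed

lemma prod_Basis_vec: "(\<Prod>b\<in>Basis. (u - l) \<bullet> b) = (\<Prod>i\<in>UNIV. u $ i - (l::real^'n::finite) $ i)"
proof -
  have "(\<Prod>b\<in>Basis. (u - l) \<bullet> b) = (\<Prod>i\<in>UNIV. (u - l) \<bullet> axis i 1)"
  proof (rule prod.reindex_cong)
    show "inj_on (\<lambda>i::'n. axis i (1::real)) UNIV" by (auto intro!: inj_onI simp: axis_eq_axis)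
    show "Basis = range (\<lambda>i::'n. axis i (1::real))" by (auto simp: Basis_vec_def)
  qed simp
  then show ?thesis by (simp add: cart_eq_inner_axis[symmetric])
qed

lemma slice_preimage_box:
  fixes l u :: "real^'n::finite"
  shows "(\<lambda>p. ext j (fst p) (snd p)) -` box l u \<inter> space (slice_measure j)
      = {l$j <..< u$j} \<times> PiE (UNIV - {j}) (\<lambda>i. {l$i <..< u$i})"
proof (intro set_eqI iffI)
  fix p :: "real \<times> ('n \<Rightarrow> real)"
  assume "p \<in> (\<lambda>p. ext j (fst p) (snd p)) -` box l u \<inter> space (slice_measure j)"
  then have 1: "\<forall>i. l $ i < ext j (fst p) (snd p) $ i \<and> ext j (fst p) (snd p) $ i < u $ i"
    and 2: "snd p \<in> PiE (UNIV - {j}) (\<lambda>_. UNIV)"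
    by (auto simp: slice_measure_def space_pair_measure space_PiM mem_box_cart)
  have "fst p \<in> {l$j <..< u$j}" using 1[rule_format, of j] by (simp add: ext_nth)
  moreover have "\<forall>i\<in>UNIV-{j}. snd p i \<in> {l$i<..<u$i}"
  proof
    fix i assume "i \<in> UNIV - {j}"
    then show "snd p i \<in> {l$i<..<u$i}" using 1[rule_format, of i] by (simp add: ext_nth)
  qed
  then have "snd p \<in> PiE (UNIV - {j}) (\<lambda>i. {l$i <..< u$i})" using 2 by (simp add: PiE_iff)
  ultimately show "p \<in> {l$j <..< u$j} \<times> PiE (UNIV - {j}) (\<lambda>i. {l$i <..< u$i})"
    by (cases p) simp
next
  fix p :: "real \<times> ('n \<Rightarrow> real)"
  assume "p \<in> {l$j <..< u$j} \<times> PiE (UNIV - {j}) (\<lambda>i. {l$i <..< u$i})"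
  then show "p \<in> (\<lambda>p. ext j (fst p) (snd p)) -` box l u \<inter> space (slice_measure j)"
    by (cases p) (auto simp: slice_measure_def space_pair_measure space_PiM mem_box_cart ext_nth PiE_iff)
qed

text \<open>The slice decomposition is measure preserving: it suffices to compare the measures of
  open boxes, which are products.\<close>
lemma distr_slice_measure:
  "distr (slice_measure j) borel (\<lambda>p. ext j (fst p) (snd p)) = (lborel :: (real^'n::finite) measure)"
proof (rule lborel_eqI[symmetric])
  interpret P: product_sigma_finite "\<lambda>_::'n. lborel :: real measure" by standard
  interpret F: finite_product_sigma_finite "\<lambda>_::'n. lborel :: real measure" "UNIV - {j}" by standard simp
  fix l u :: "real^'n" assume lu: "\<And>b. b \<in> Basis \<Longrightarrow> l \<bullet> b \<le> u \<bullet> b"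
  have luc: "l $ i \<le> u $ i" for i using lu[of "axis i 1"] by (simp add: cart_eq_inner_axis)
  note pre = slice_preimage_box[of j l u]
  have "emeasure (distr (slice_measure j) borel (\<lambda>p. ext j (fst p) (snd p))) (box l u)
      = emeasure (slice_measure j) ({l$j <..< u$j} \<times> PiE (UNIV - {j}) (\<lambda>i. {l$i <..< u$i}))"
    by (subst emeasure_distr) (simp_all add: pre[symmetric])
  also have "\<dots> = emeasure lborel {l$j <..< u$j}
      * emeasure (PiM (UNIV - {j}) (\<lambda>_::'n. lborel :: real measure)) (PiE (UNIV - {j}) (\<lambda>i. {l$i <..< u$i}))"
    unfolding slice_measure_def by (rule F.emeasure_pair_measure_Times) auto
  also have "\<dots> = ennreal (u$j - l$j) * (\<Prod>i\<in>UNIV - {j}. ennreal (u$i - l$i))"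
    by (subst P.emeasure_PiM) (auto simp: luc)
  also have "\<dots> = ennreal (\<Prod>i\<in>UNIV. u$i - l$i)"
    by (simp add: prod_ennreal luc ennreal_mult[symmetric] prod.remove[of UNIV j] prod_nonneg)
  finally show "emeasure (distr (slice_measure j) borel (\<lambda>p. ext j (fst p) (snd p))) (box l u)
      = ennreal (\<Prod>b\<in>Basis. (u - l) \<bullet> b)"
    by (simp add: prod_Basis_vec)
qed simp

lemma AE_slice_not_in_null:
  assumes N: "N \<in> null_sets (lborel :: (real^'n::finite) measure)"
  shows "AE p in slice_measure j. ext j (fst p) (snd p) \<notin> N"
proof (rule AE_I')
  have Nb: "N \<in> sets borel" using N by (simp add: null_sets_def)
  have "emeasure (slice_measure j) ((\<lambda>p. ext j (fst p) (snd p)) -` N \<inter> space (slice_measure j))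
      = emeasure (distr (slice_measure j) borel (\<lambda>p. ext j (fst p) (snd p))) N"
    using Nb by (subst emeasure_distr) auto
  also have "\<dots> = 0" using null_setsD1[OF N] by (simp add: distr_slice_measure)
  finally show "(\<lambda>p. ext j (fst p) (snd p)) -` N \<inter> space (slice_measure j) \<in> null_sets (slice_measure j)"
    using Nb by (auto simp: null_sets_def)
qed auto

lemma AE_fibres_eq:
  fixes u ub :: "real^'n::finite \<Rightarrow> 'b"
  assumes "AE y in lborel. u y = ub y"
  shows "AE t in lborel. AE z in PiM (UNIV - {j}) (\<lambda>_. lborel). u (ext j t z) = ub (ext j t z)"
proof -
  interpret F: finite_product_sigma_finite "\<lambda>_::'n. lborel :: real measure" "UNIV - {j}" by standard simp
  interpret PS: pair_sigma_finite lborel "PiM (UNIV - {j}) (\<lambda>_::'n. lborel :: real measure)" by standard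
  obtain N where N: "N \<in> null_sets lborel" "{y\<in>space lborel. u y \<noteq> ub y} \<subseteq> N"
    using assms unfolding eventually_ae_filter by blast
  have "AE p in slice_measure j. ext j (fst p) (snd p) \<notin> N" by (rule AE_slice_not_in_null[OF N(1)])
  then have "AE p in slice_measure j. u (ext j (fst p) (snd p)) = ub (ext j (fst p) (snd p))"
    by eventually_elim (use N(2) in auto)
  from PS.AE_pair[OF this[unfolded slice_measure_def]] show ?thesis by simp
qed

lemma completion_AE_measurable:
  assumes g: "g \<in> M \<rightarrow>\<^sub>M N" and ae: "AE x in M. f x = g x" and sp: "\<And>x. x \<in> space M \<Longrightarrow> f x \<in> space N"
  shows "f \<in> completion M \<rightarrow>\<^sub>M N"
proof (rule measurableI)
  obtain Z where Z: "Z \<in> null_sets M" "{x\<in>space M. f x \<noteq> g x} \<subseteq> Z"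
    using ae by (auto elim!: AE_E)
  fix B assume B: "B \<in> sets N"
  have "f -` B \<inter> space (completion M) = ((g -` B \<inter> space M) - Z) \<union> (f -` B \<inter> space M \<inter> Z)"
    using Z by auto
  moreover have "(g -` B \<inter> space M) - Z \<in> sets (completion M)"
    using g B Z by (intro sets_completionI_sets) (auto intro: measurable_sets)
  moreover have "f -` B \<inter> space M \<inter> Z \<in> null_sets (completion M)"
    by (rule null_sets_completion_subset[of _ Z]) (use Z in \<open>auto intro: null_sets_completionI\<close>)
  ultimately show "f -` B \<inter> space (completion M) \<in> sets (completion M)"
    by (metis (no_types) sets.Un null_setsD2 space_completion)
qed (use sp in simp)

lemma nn_integral_sliced:
  fixes u :: "real^'n::finite \<Rightarrow> ennreal"
  assumes u: "u \<in> borel_measurable lebesgue"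
  shows "\<exists>W \<in> borel_measurable lborel. (\<integral>\<^sup>+ y. u y \<partial>lebesgue) = (\<integral>\<^sup>+ t. W t \<partial>lborel)
           \<and> (AE t in lborel. (\<lambda>z. u (ext j t z)) \<in> borel_measurable (Mfib j) \<and> W t = (\<integral>\<^sup>+ z. u (ext j t z) \<partial>Mfib j))"
proof -
  interpret F: finite_product_sigma_finite "\<lambda>_::'n. lborel :: real measure" "UNIV - {j}" by standard simp
  let ?M2 = "PiM (UNIV - {j}) (\<lambda>_::'n. lborel :: real measure)"
  obtain ub where ub: "ub \<in> borel_measurable lborel" and ae: "AE y in lborel. u y = ub y"
    using completion_ex_borel_measurable[OF u] by blast
  have ubb[measurable]: "ub \<in> borel_measurable borel" using ub by simp
  define W where "W t = (\<integral>\<^sup>+ z. ub (ext j t z) \<partial>?M2)" for t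
  have Pm: "(\<lambda>p. ub (ext j (fst p) (snd p))) \<in> borel_measurable (lborel \<Otimes>\<^sub>M ?M2)"
    using measurable_compose[OF ext_measurable ubb] unfolding slice_measure_def .
  have "(\<integral>\<^sup>+ y. u y \<partial>lebesgue) = (\<integral>\<^sup>+ y. ub y \<partial>lborel)"
    by (simp add: nn_integral_completion ae nn_integral_cong_AE)
  also have "\<dots> = (\<integral>\<^sup>+ p. ub (ext j (fst p) (snd p)) \<partial>slice_measure j)"
    by (subst distr_slice_measure[symmetric]) (rule nn_integral_distr; simp)
  also have "\<dots> = (\<integral>\<^sup>+ t. W t \<partial>lborel)"
    unfolding slice_measure_def W_def using F.nn_integral_fst[OF Pm] by simp
  finally have eq: "(\<integral>\<^sup>+ y. u y \<partial>lebesgue) = (\<integral>\<^sup>+ t. W t \<partial>lborel)" .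
  have "AE t in lborel. (\<lambda>z. u (ext j t z)) \<in> borel_measurable (Mfib j) \<and> W t = (\<integral>\<^sup>+ z. u (ext j t z) \<partial>Mfib j)"
    using AE_fibres_eq[OF ae, of j]
  proof eventually_elim
    case (elim t)
    have m1: "(\<lambda>z. ub (ext j t z)) \<in> borel_measurable ?M2"
      using measurable_Pair2[OF Pm, of t] by simp
    have "(\<lambda>z. u (ext j t z)) \<in> borel_measurable (Mfib j)"
      unfolding Mfib_def by (rule completion_AE_measurable[OF m1]) (use elim in auto)
    moreover have "(\<integral>\<^sup>+ z. u (ext j t z) \<partial>Mfib j) = (\<integral>\<^sup>+ z. ub (ext j t z) \<partial>Mfib j)"
      unfolding Mfib_def by (rule nn_integral_cong_AE) (use elim in \<open>auto intro: AE_completion\<close>)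
    moreover have "\<dots> = W t" unfolding Mfib_def W_def by (rule nn_integral_completion)
    ultimately show ?case by simp
  qed
  moreover have "W \<in> borel_measurable lborel"
    unfolding W_def using F.borel_measurable_nn_integral_fst[OF Pm] by simp
  ultimately show ?thesis using eq by blast
qed

lemma integrable_lebesgue_borel_version:
  fixes u :: "'a::euclidean_space \<Rightarrow> real"
  assumes u: "integrable lebesgue u"
  obtains ub where "ub \<in> borel_measurable borel" "integrable lborel ub" "AE y in lborel. u y = ub y"
    "(\<integral> y. u y \<partial>lebesgue) = (\<integral> y. ub y \<partial>lborel)"
proof -
  have um: "u \<in> borel_measurable lebesgue" using u by auto
  obtain ub where ub: "ub \<in> borel_measurable lborel" and ae: "AE y in lborel. u y = ub y"
    using completion_ex_borel_measurable_real[OF um] by blast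
  have "integrable lebesgue ub"
    using u by (rule integrable_cong_AE_imp) (use ae ub in \<open>auto intro: AE_completion measurable_completion\<close>)
  then have "integrable lborel ub" using integrable_completion[of ub lborel] ub by simp
  moreover have "(\<integral> y. u y \<partial>lebesgue) = (\<integral> y. ub y \<partial>lebesgue)"
    by (rule integral_cong_AE) (use ae um ub in \<open>auto intro: AE_completion measurable_completion\<close>)
  then have "(\<integral> y. u y \<partial>lebesgue) = (\<integral> y. ub y \<partial>lborel)"
    using integral_completion[of ub lborel] ub by simp
  ultimately show ?thesis using that ub ae by simp
qed

lemma integral_borel_slice:
  fixes ub :: "real^'n::finite \<Rightarrow> real"
  assumes ub[measurable]: "ub \<in> borel_measurable borel" and ubi: "integrable lborel ub"
  shows "integrable (lborel \<Otimes>\<^sub>M PiM (UNIV - {j}) (\<lambda>_. lborel)) (\<lambda>p. ub (ext j (fst p) (snd p)))"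
    and "(\<integral> y. ub y \<partial>lborel) = (\<integral> p. ub (ext j (fst p) (snd p)) \<partial>(lborel \<Otimes>\<^sub>M PiM (UNIV - {j}) (\<lambda>_. lborel)))"
proof -
  have "integrable (distr (slice_measure j) borel (\<lambda>p. ext j (fst p) (snd p))) ub"
    using ubi by (simp add: distr_slice_measure)
  then show "integrable (lborel \<Otimes>\<^sub>M PiM (UNIV - {j}) (\<lambda>_. lborel)) (\<lambda>p. ub (ext j (fst p) (snd p)))"
    by (subst (asm) integrable_distr_eq) (use ext_measurable[of j] in \<open>auto simp: slice_measure_def\<close>)
  have "(\<integral> y. ub y \<partial>lborel) = (\<integral> y. ub y \<partial>distr (slice_measure j) borel (\<lambda>p. ext j (fst p) (snd p)))"
    by (simp add: distr_slice_measure)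
  also have "\<dots> = (\<integral> p. ub (ext j (fst p) (snd p)) \<partial>slice_measure j)"
    by (rule integral_distr) auto
  finally show "(\<integral> y. ub y \<partial>lborel) = (\<integral> p. ub (ext j (fst p) (snd p)) \<partial>(lborel \<Otimes>\<^sub>M PiM (UNIV - {j}) (\<lambda>_. lborel)))"
    by (simp add: slice_measure_def)
qed

lemma integral_sliced:
  fixes u :: "real^'n::finite \<Rightarrow> real"
  assumes u: "integrable lebesgue u"
  shows "\<exists>F \<in> borel_measurable lborel. integrable lborel F \<and> (\<integral> y. u y \<partial>lebesgue) = (\<integral> t. F t \<partial>lborel)
           \<and> (AE t in lborel. integrable (Mfib j) (\<lambda>z. u (ext j t z)) \<and> F t = (\<integral> z. u (ext j t z) \<partial>Mfib j))"
proof -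
  interpret F: finite_product_sigma_finite "\<lambda>_::'n. lborel :: real measure" "UNIV - {j}" by standard simp
  interpret PS: pair_sigma_finite lborel "PiM (UNIV - {j}) (\<lambda>_::'n. lborel :: real measure)" by standard
  let ?M2 = "PiM (UNIV - {j}) (\<lambda>_::'n. lborel :: real measure)"
  obtain ub where ubb[measurable]: "ub \<in> borel_measurable borel" and ubi: "integrable lborel ub"
    and ae: "AE y in lborel. u y = ub y" and int1: "(\<integral> y. u y \<partial>lebesgue) = (\<integral> y. ub y \<partial>lborel)"
    using integrable_lebesgue_borel_version[OF u] by blast
  have Pm: "(\<lambda>p. ub (ext j (fst p) (snd p))) \<in> borel_measurable (lborel \<Otimes>\<^sub>M ?M2)"
    using measurable_compose[OF ext_measurable ubb] unfolding slice_measure_def .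
  note Pi = integral_borel_slice(1)[OF ubb ubi, of j]
  define F where "F t = (\<integral> z. ub (ext j t z) \<partial>?M2)" for t
  have "(\<lambda>(t,z). ub (ext j t z)) \<in> borel_measurable (lborel \<Otimes>\<^sub>M ?M2)"
    using Pm by (simp add: split_beta')
  then have Fm: "F \<in> borel_measurable lborel"
    unfolding F_def by (rule F.borel_measurable_lebesgue_integral)
  have Fi: "integrable lborel F"
    unfolding F_def using PS.integrable_fst'[OF Pi] by simp
  have int2: "(\<integral> y. u y \<partial>lebesgue) = (\<integral> t. F t \<partial>lborel)"
    unfolding int1 integral_borel_slice(2)[OF ubb ubi, of j] F_def using PS.integral_fst'[OF Pi] by simp
  have "AE t in lborel. integrable (Mfib j) (\<lambda>z. u (ext j t z)) \<and> F t = (\<integral> z. u (ext j t z) \<partial>Mfib j)"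
    using AE_fibres_eq[OF ae, of j] PS.AE_integrable_fst'[OF Pi]
  proof eventually_elim
    case (elim t)
    have m1: "(\<lambda>z. ub (ext j t z)) \<in> borel_measurable ?M2"
      using measurable_Pair2[OF Pm, of t] by simp
    have m2: "(\<lambda>z. u (ext j t z)) \<in> borel_measurable (Mfib j)"
      unfolding Mfib_def by (rule completion_AE_measurable[OF m1]) (use elim in auto)
    have ae2: "AE z in Mfib j. u (ext j t z) = ub (ext j t z)"
      unfolding Mfib_def using elim by (auto intro: AE_completion)
    have "integrable (Mfib j) (\<lambda>z. ub (ext j t z))"
      unfolding Mfib_def using integrable_completion[OF m1] elim by simp
    then have "integrable (Mfib j) (\<lambda>z. u (ext j t z))"
      by (rule integrable_cong_AE_imp[OF _ m2]) (use ae2 in \<open>auto elim: AE_mp\<close>)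
    moreover have "(\<integral> z. u (ext j t z) \<partial>Mfib j) = (\<integral> z. ub (ext j t z) \<partial>Mfib j)"
      by (rule integral_cong_AE[OF m2]) (use ae2 m1 in \<open>auto simp: Mfib_def intro: measurable_completion\<close>)
    moreover have "(\<integral> z. ub (ext j t z) \<partial>Mfib j) = F t"
      unfolding Mfib_def F_def by (rule integral_completion[OF m1])
    ultimately show ?case by simp
  qed
  with Fm Fi int2 show ?thesis by auto
qed

section \<open>Best approximation in L2 and orthogonality\<close>

lemma L2_mult:
  assumes "L2 X u" "L2 X v"
  shows "integrable (lebesgue_on X) (\<lambda>x. u x * v x)"
proof (rule Bochner_Integration.integrable_bound)
  show "integrable (lebesgue_on X) (\<lambda>x. (u x)^2 + (v x)^2)"
    using assms unfolding L2_def by auto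
  show "(\<lambda>x. u x * v x) \<in> borel_measurable (lebesgue_on X)"
    using assms unfolding L2_def by auto
  show "AE x in lebesgue_on X. norm (u x * v x) \<le> norm ((u x)^2 + (v x)^2)"
  proof (rule AE_I2)
    fix x
    have "2 * (\<bar>u x\<bar> * \<bar>v x\<bar>) \<le> (u x)^2 + (v x)^2"
      using zero_le_power2[of "\<bar>u x\<bar> - \<bar>v x\<bar>"] by (simp add: power2_diff)
    then have "\<bar>u x\<bar> * \<bar>v x\<bar> \<le> (u x)^2 + (v x)^2"
      using mult_nonneg_nonneg[OF abs_ge_zero abs_ge_zero, of "u x" "v x"] by linarith
    then show "norm (u x * v x) \<le> norm ((u x)^2 + (v x)^2)"
      by (simp add: abs_mult)
  qed
qed

lemma L2_add:
  assumes "L2 X u" "L2 X v" shows "L2 X (\<lambda>x. u x + v x)"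
proof -
  have "integrable (lebesgue_on X) (\<lambda>x. (u x)^2 + (v x)^2 + 2 * (u x * v x))"
    using assms L2_mult[OF assms] unfolding L2_def
    by (intro Bochner_Integration.integrable_add integrable_mult_right) auto
  moreover have "(\<lambda>x. (u x + v x)^2) = (\<lambda>x. (u x)^2 + (v x)^2 + 2 * (u x * v x))"
    by (rule ext) (simp add: power2_sum)
  ultimately show ?thesis using assms by (auto simp: L2_def)
qed

lemma L2_cmult:
  assumes "L2 X u" shows "L2 X (\<lambda>x. c * u x)"
proof -
  have "integrable (lebesgue_on X) (\<lambda>x. c^2 * (u x)^2)"
    using assms by (auto simp: L2_def)
  then show ?thesis using assms by (auto simp: L2_def power_mult_distrib)
qed

lemma L2_zero: "L2 X (\<lambda>x. 0)"
  by (simp add: L2_def)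

lemma L2_diff:
  assumes "L2 X u" "L2 X v" shows "L2 X (\<lambda>x. u x - v x)"
  using L2_add[OF assms(1) L2_cmult[OF assms(2), of "-1"]] by simp

lemma L2_sum:
  assumes "\<And>i. i \<in> I \<Longrightarrow> L2 X (u i)" shows "L2 X (\<lambda>x. \<Sum>i\<in>I. u i x)"
  using assms
  by (induction I rule: infinite_finite_induct) (simp_all add: L2_zero L2_add)

lemma L2_sq_expand:
  assumes e: "L2 X e" and \<phi>: "L2 X \<phi>"
  shows "(\<integral>x. (e x - s * \<phi> x)^2 \<partial>lebesgue_on X)
       = (\<integral>x. (e x)^2 \<partial>lebesgue_on X) - 2 * s * (\<integral>x. e x * \<phi> x \<partial>lebesgue_on X)
         + s^2 * (\<integral>x. (\<phi> x)^2 \<partial>lebesgue_on X)"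
proof -
  let ?M = "lebesgue_on X"
  have i1: "integrable ?M (\<lambda>x. (e x)^2)" and i3: "integrable ?M (\<lambda>x. (\<phi> x)^2)"
    using e \<phi> by (simp_all add: L2_def)
  have i2: "integrable ?M (\<lambda>x. e x * \<phi> x)" using L2_mult[OF e \<phi>] .
  have "(\<lambda>x. (e x - s * \<phi> x)^2) = (\<lambda>x. ((e x)^2 - (2 * s) * (e x * \<phi> x)) + s^2 * (\<phi> x)^2)"
    by (rule ext) (simp add: power2_eq_square algebra_simps)
  then have "(\<integral>x. (e x - s * \<phi> x)^2 \<partial>?M) = (\<integral>x. ((e x)^2 - (2 * s) * (e x * \<phi> x)) + s^2 * (\<phi> x)^2 \<partial>?M)"
    by simp
  also have "\<dots> = (\<integral>x. (e x)^2 - (2 * s) * (e x * \<phi> x) \<partial>?M) + (\<integral>x. s^2 * (\<phi> x)^2 \<partial>?M)"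
    by (rule Bochner_Integration.integral_add) (use i1 i2 i3 in auto)
  also have "(\<integral>x. (e x)^2 - (2 * s) * (e x * \<phi> x) \<partial>?M) = (\<integral>x. (e x)^2 \<partial>?M) - (\<integral>x. (2 * s) * (e x * \<phi> x) \<partial>?M)"
    by (rule Bochner_Integration.integral_diff) (use i1 i2 in auto)
  finally show ?thesis by simp
qed

text \<open>If the quadratic s \<mapsto> s^2 d - 2 s c (with d \<ge> 0) is nonnegative, then c = 0:
  otherwise s = c / (d + 1) makes it negative.\<close>
lemma quadratic_nonneg_imp_zero_slope:
  fixes c d :: real
  assumes d: "d \<ge> 0" and le: "\<And>s. 2 * s * c \<le> s^2 * d"
  shows "c = 0"
proof (rule ccontr)
  assume "c \<noteq> 0"
  define s where "s = c / (d + 1)"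
  have "s^2 * d = (c^2 / (d+1)) * (d / (d+1))"
    unfolding s_def by (simp add: power_divide power2_eq_square)
  also have "\<dots> < (c^2 / (d+1)) * 2"
    using \<open>c \<noteq> 0\<close> d by (intro mult_strict_left_mono) (auto simp: divide_less_eq)
  also have "\<dots> = 2 * s * c" unfolding s_def by (simp add: power2_eq_square)
  finally show False using le[of s] by linarith
qed

text \<open>At a best approximation h, the residual is orthogonal to every direction \<phi> along which
  R is closed at h: otherwise moving along \<phi> would decrease the distance.\<close>
lemma orth_if_best_approx:
  assumes best: "best_approx X R f h" and f: "L2 X f" and h: "L2 X h" and \<phi>: "L2 X \<phi>"
    and cl: "\<And>s. (\<lambda>x. h x + s * \<phi> x) \<in> R"
  shows "(\<integral>x. (f x - h x) * \<phi> x \<partial>lebesgue_on X) = 0"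
proof -
  let ?M = "lebesgue_on X"
  define e where "e x = f x - h x" for x
  have e: "L2 X e" unfolding e_def by (rule L2_diff[OF f h])
  have dist_line: "L2_dist X f (\<lambda>x. h x + s * \<phi> x) = sqrt (\<integral>x. (e x - s * \<phi> x)^2 \<partial>?M)" for s
    unfolding L2_dist_def e_def by (simp add: algebra_simps)
  have "2 * s * (\<integral>x. e x * \<phi> x \<partial>?M) \<le> s^2 * (\<integral>x. (\<phi> x)^2 \<partial>?M)" for s
  proof -
    have "L2_dist X f (\<lambda>x. h x + 0 * \<phi> x) \<le> L2_dist X f (\<lambda>x. h x + s * \<phi> x)"
      using best cl unfolding best_approx_def by simp
    then show ?thesis
      unfolding dist_line L2_sq_expand[OF e \<phi>] by simp
  qed
  then have "(\<integral>x. e x * \<phi> x \<partial>?M) = 0"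
    by (rule quadratic_nonneg_imp_zero_slope[rotated]) (rule integral_nonneg_AE, simp)
  then show ?thesis unfolding e_def .
qed

text \<open>Conversely, if the residual at h \<in> R is orthogonal to all of R, then h is a best
  approximation (Pythagoras).\<close>
lemma best_approx_if_orth:
  assumes f: "L2 X f" and RL2: "\<And>\<psi>. \<psi> \<in> R \<Longrightarrow> L2 X \<psi>" and h: "h \<in> R"
    and orth: "\<And>\<psi>. \<psi> \<in> R \<Longrightarrow> (\<integral>x. (f x - h x) * \<psi> x \<partial>lebesgue_on X) = 0"
  shows "best_approx X R f h"
  unfolding best_approx_def
proof (intro conjI ballI h)
  let ?M = "lebesgue_on X"
  define e where "e x = f x - h x" for x
  have e: "L2 X e" unfolding e_def by (rule L2_diff[OF f RL2[OF h]])
  have dist: "L2_dist X f u = sqrt (\<integral>x. (e x - 1 * (u x - h x))^2 \<partial>?M)" for u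
    unfolding L2_dist_def e_def by (simp add: algebra_simps)
  fix h' assume h': "h' \<in> R"
  have L: "L2 X (\<lambda>x. h' x - h x)" by (rule L2_diff[OF RL2[OF h'] RL2[OF h]])
  have "(\<integral>x. e x * (h' x - h x) \<partial>?M) = (\<integral>x. e x * h' x - e x * h x \<partial>?M)"
    by (simp add: algebra_simps)
  also have "\<dots> = 0"
    using orth[OF h'] orth[OF h] L2_mult[OF e RL2[OF h']] L2_mult[OF e RL2[OF h]]
    by (simp add: e_def)
  finally have "(\<integral>x. e x * (h' x - h x) \<partial>?M) = 0" .
  moreover have "0 \<le> (\<integral>x. (h' x - h x)^2 \<partial>?M)" by (rule integral_nonneg_AE) auto
  ultimately have "(\<integral>x. (e x - 1 * 0)^2 \<partial>?M) \<le> (\<integral>x. (e x - 1 * (h' x - h x))^2 \<partial>?M)"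
    unfolding L2_sq_expand[OF e L] L2_sq_expand[OF e L2_zero] by simp
  then show "L2_dist X f h \<le> L2_dist X f h'"
    unfolding dist by simp
qed

lemma best_approx_iff_orth:
  assumes f: "L2 X f" and RL2: "\<And>\<psi>. \<psi> \<in> R \<Longrightarrow> L2 X \<psi>" and h: "h \<in> R"
    and V: "\<And>\<phi>. \<phi> \<in> V \<Longrightarrow> L2 X \<phi>"
    and cl: "\<And>\<phi> s. \<phi> \<in> V \<Longrightarrow> (\<lambda>x. h x + s * \<phi> x) \<in> R"
    and span: "\<And>\<psi>. \<psi> \<in> R \<Longrightarrow> (\<forall>\<phi>\<in>V. (\<integral>x. (f x - h x) * \<phi> x \<partial>lebesgue_on X) = 0)
                   \<Longrightarrow> (\<integral>x. (f x - h x) * \<psi> x \<partial>lebesgue_on X) = 0"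
  shows "best_approx X R f h \<longleftrightarrow> (\<forall>\<phi>\<in>V. (\<integral>x. (f x - h x) * \<phi> x \<partial>lebesgue_on X) = 0)"
  using orth_if_best_approx[OF _ f RL2[OF h] V cl] best_approx_if_orth[OF f RL2 h span] by blast

section \<open>Truncation levels\<close>

definition level_set :: "('a \<Rightarrow> ennreal) \<Rightarrow> ('a \<Rightarrow> real) \<Rightarrow> nat \<Rightarrow> 'a set" where
  "level_set W F n = {t. W t \<le> ennreal (real n) \<and> \<bar>F t\<bar> \<le> real n}"

lemma level_set_exhaust:
  assumes "W t < \<infinity>"
  shows "\<exists>n. t \<in> level_set W F n"
proof
  define n where "n = nat \<lceil>max (enn2real (W t)) \<bar>F t\<bar>\<rceil>"
  have c: "max (enn2real (W t)) \<bar>F t\<bar> \<le> real n" unfolding n_def by (rule real_nat_ceiling_ge)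
  have "W t = ennreal (enn2real (W t))" using assms by simp
  also have "\<dots> \<le> ennreal (real n)" using c by (intro ennreal_leI) simp
  finally show "t \<in> level_set W F n" using c by (simp add: level_set_def)
qed

text \<open>If |x| \<le> n and m \<le> n then x^2 m \<le> n^2 |x|: on a level set of (W, F), the weighted square
  F^2 W is dominated by the integrable function n^2 |F|.\<close>
lemma truncation_weight_bound:
  fixes x :: real and m :: ennreal
  assumes x: "\<bar>x\<bar> \<le> real n" and m: "m \<le> ennreal (real n)"
  shows "ennreal (x^2) * m \<le> ennreal (real n * real n * \<bar>x\<bar>)"
proof -
  have "ennreal (x^2) * m \<le> ennreal (x^2) * ennreal (real n)"
    using m by (rule mult_left_mono) simp
  also have "\<dots> \<le> ennreal (real n * real n * \<bar>x\<bar>)"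
    unfolding ennreal_mult[symmetric, OF zero_le_power2 of_nat_0_le_iff]
  proof (rule ennreal_leI)
    have "x^2 = \<bar>x\<bar> * \<bar>x\<bar>" by (simp add: power2_eq_square)
    also have "\<dots> \<le> real n * \<bar>x\<bar>" using x by (intro mult_right_mono) auto
    finally show "x^2 * real n \<le> real n * real n * \<bar>x\<bar>"
      using mult_right_mono[of "x^2" "real n * \<bar>x\<bar>" "real n"] by (simp add: mult_ac)
  qed
  finally show ?thesis .
qed

lemma indicator_mult_ennreal: "indicator A z * ennreal c = ennreal (indicator A z * c)"
  by (simp split: split_indicator)

section \<open>The ridge approximation problem over an r-set\<close>

locale ridge_problem =
  fixes X :: "(real^'n::finite) set" and I :: "'n set" and a :: "'n \<Rightarrow> real^'n"
    and w :: "'n \<Rightarrow> real^'n \<Rightarrow> real" and f :: "real^'n \<Rightarrow> real"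
    and g0 :: "'n \<Rightarrow> real \<Rightarrow> real" and Y0 :: "('n \<Rightarrow> real) set"
  assumes X_meas: "X \<in> sets lebesgue"
    and basis: "invertible (Jmat a)"
    and w_L2: "\<forall>i\<in>I. L2 X (w i)"
    and rset: "(\<lambda>x. Jmat a *v x) ` X =
       {y. (\<forall>i\<in>I. y $ i \<in> proj_set X a i) \<and> restrict (\<lambda>k. y $ k) (- I) \<in> Y0}"
    and f_L2: "L2 X f"
    and g0_L2: "\<forall>i\<in>I. L2 X (\<lambda>x. w i x * g0 i (a i \<bullet> x))"
    and W_pos: "\<forall>j\<in>I. AE t in lborel. t \<in> proj_set X a j \<longrightarrow>
       0 < (\<integral>\<^sup>+ z. indicator (fibre_set I (proj_set X a) Y0 j) z
                  * ennreal ((ustar a (w j) (ext j t z))^2) \<partial>Mfib j)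
     \<and> (\<integral>\<^sup>+ z. indicator (fibre_set I (proj_set X a) Y0 j) z
                  * ennreal ((ustar a (w j) (ext j t z))^2) \<partial>Mfib j) < \<infinity>"
begin

definition "Jf = (\<lambda>x. Jmat a *v x)"
definition "Tf = (\<lambda>y. matrix_inv (Jmat a) *v y)"
definition "jac = (SOME k. linear_change Jf Tf k)"

definition "h = (\<lambda>x. \<Sum>i\<in>I. w i x * g0 i (a i \<bullet> x))"

abbreviation "Ycoord j \<equiv> proj_set X a j"
abbreviation "Yfib j \<equiv> fibre_set I (proj_set X a) Y0 j"
abbreviation "fibre_mass j t \<equiv>
  \<integral>\<^sup>+ z. indicator (Yfib j) z * ennreal ((ustar a (w j) (ext j t z))^2) \<partial>Mfib j"
abbreviation "fibre_moment j t \<equiv>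
  \<integral> z. indicator (Yfib j) z
        * (ustar a f (ext j t z) - (\<Sum>i\<in>I - {j}. ustar a (w i) (ext j t z) * g0 i (ext j t z $ i)))
        * ustar a (w j) (ext j t z) \<partial>Mfib j"

definition "resid_moment j t =
  (\<integral>z. indicator (Yfib j) z * ((f (Tf (ext j t z)) - h (Tf (ext j t z))) * w j (Tf (ext j t z))) \<partial>Mfib j)"

definition "residual_orth j \<longleftrightarrow>
  (\<forall>g. L2 X (\<lambda>x. w j x * g (a j \<bullet> x)) \<longrightarrow> (\<integral>x. (f x - h x) * (w j x * g (a j \<bullet> x)) \<partial>lebesgue_on X) = 0)"

lemma J_change: "linear_change Jf Tf jac"
  unfolding jac_def Jf_def Tf_def using linear_change_Jmat[OF basis] by (rule someI_ex)

lemma jac_pos: "jac > 0"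
  using linear_change.k_pos[OF J_change] .

lemma a_Tf: "a i \<bullet> Tf y = y $ i"
proof -
  have "Jf (Tf y) $ i = a i \<bullet> Tf y"
    by (simp add: Jf_def Jmat_def matrix_vector_mul_component)
  then show ?thesis using linear_change.JT[OF J_change] by simp
qed

lemma a_Tf_ext: "a j \<bullet> Tf (ext j t z) = t"
  by (simp add: a_Tf ext_nth)

lemma ustar_Tf: "ustar a u y = u (Tf y)"
  by (simp add: ustar_def Tf_def)

lemma ext_in_JX_iff:
  assumes j: "j \<in> I"
  shows "ext j t z \<in> Jf ` X \<longleftrightarrow> t \<in> Ycoord j \<and> z \<in> Yfib j"
proof -
  have r: "restrict (\<lambda>k. ext j t z $ k) (- I) = restrict z (- I)"
    using j by (auto simp: restrict_def ext_nth)
  have "(\<forall>i\<in>I. ext j t z $ i \<in> Ycoord i) \<longleftrightarrow> t \<in> Ycoord j \<and> (\<forall>k\<in>I - {j}. z k \<in> Ycoord k)"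
    using j by (auto simp: ext_nth)
  then show ?thesis
    unfolding Jf_def rset fibre_set_def by (simp add: r)
qed

lemma indicator_JX_ext:
  "j \<in> I \<Longrightarrow> indicator (Jf ` X) (ext j t z) * c = (if t \<in> Ycoord j then indicator (Yfib j) z * c else (0::real))"
  using ext_in_JX_iff[of j t z] by (simp add: indicator_def)

lemma resid_L2: "L2 X (\<lambda>x. f x - h x)"
  unfolding h_def by (intro L2_diff[OF f_L2] L2_sum) (use g0_L2 in auto)

lemma ridge_set_add_component:
  assumes j: "j \<in> I" and gL2: "L2 X (\<lambda>x. w j x * g (a j \<bullet> x))"
  shows "(\<lambda>x. h x + s * (w j x * g (a j \<bullet> x))) \<in> ridge_set X I a w"
proof -
  define g' where "g' i t = g0 i t + (if i = j then s * g t else 0)" for i t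
  have eq: "w i x * g' i (a i \<bullet> x) = w i x * g0 i (a i \<bullet> x) + (if i = j then s * (w j x * g (a j \<bullet> x)) else 0)" for i x
    by (simp add: g'_def algebra_simps)
  have "(\<lambda>x. h x + s * (w j x * g (a j \<bullet> x))) = (\<lambda>x. \<Sum>i\<in>I. w i x * g' i (a i \<bullet> x))"
    by (rule ext) (simp add: eq sum.distrib h_def j)
  moreover have "L2 X (\<lambda>x. w i x * g' i (a i \<bullet> x))" if i: "i \<in> I" for i
    unfolding eq
  proof (rule L2_add)
    show "L2 X (\<lambda>x. w i x * g0 i (a i \<bullet> x))" using g0_L2 i by blast
    show "L2 X (\<lambda>x. if i = j then s * (w j x * g (a j \<bullet> x)) else 0)"
      by (cases "i = j") (simp_all add: L2_cmult[OF gL2] L2_zero)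
  qed
  ultimately show ?thesis unfolding ridge_set_def by blast
qed

lemma best_approx_iff_residual_orth:
  "best_approx X (ridge_set X I a w) f h \<longleftrightarrow> (\<forall>j\<in>I. residual_orth j)"
proof -
  define V where "V = {(\<lambda>x. w j x * g (a j \<bullet> x)) | j g. j \<in> I \<and> L2 X (\<lambda>x. w j x * g (a j \<bullet> x))}"
  have RL2: "L2 X \<psi>" if "\<psi> \<in> ridge_set X I a w" for \<psi>
    using that unfolding ridge_set_def by (auto intro!: L2_sum)
  have hR: "h \<in> ridge_set X I a w"
    unfolding ridge_set_def h_def using g0_L2 by blast
  have VL2: "L2 X \<phi>" if "\<phi> \<in> V" for \<phi> using that unfolding V_def by auto
  have cl: "(\<lambda>x. h x + s * \<phi> x) \<in> ridge_set X I a w" if "\<phi> \<in> V" for \<phi> s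
    using that ridge_set_add_component unfolding V_def by blast
  have span: "(\<integral>x. (f x - h x) * \<psi> x \<partial>lebesgue_on X) = 0"
    if \<psi>: "\<psi> \<in> ridge_set X I a w" and orth: "\<forall>\<phi>\<in>V. (\<integral>x. (f x - h x) * \<phi> x \<partial>lebesgue_on X) = 0" for \<psi>
  proof -
    obtain g where gL2: "\<forall>i\<in>I. L2 X (\<lambda>x. w i x * g i (a i \<bullet> x))" and \<psi>eq: "\<psi> = (\<lambda>x. \<Sum>i\<in>I. w i x * g i (a i \<bullet> x))"
      using \<psi> unfolding ridge_set_def by blast
    have "(\<integral>x. (f x - h x) * \<psi> x \<partial>lebesgue_on X) = (\<Sum>i\<in>I. (\<integral>x. (f x - h x) * (w i x * g i (a i \<bullet> x)) \<partial>lebesgue_on X))"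
      unfolding \<psi>eq sum_distrib_left
      by (rule Bochner_Integration.integral_sum) (use gL2 L2_mult[OF resid_L2] in blast)
    also have "\<dots> = 0"
    proof (rule sum.neutral, rule ballI)
      fix i assume "i \<in> I"
      then have "(\<lambda>x. w i x * g i (a i \<bullet> x)) \<in> V" unfolding V_def using gL2 by blast
      from bspec[OF orth this]
      show "(\<integral>x. (f x - h x) * (w i x * g i (a i \<bullet> x)) \<partial>lebesgue_on X) = 0" by simp
    qed
    finally show ?thesis .
  qed
  have "best_approx X (ridge_set X I a w) f h \<longleftrightarrow> (\<forall>\<phi>\<in>V. (\<integral>x. (f x - h x) * \<phi> x \<partial>lebesgue_on X) = 0)"
    by (rule best_approx_iff_orth[OF f_L2 RL2 hR VL2 cl span])
  also have "\<dots> \<longleftrightarrow> (\<forall>j\<in>I. residual_orth j)"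
    unfolding V_def residual_orth_def by auto
  finally show ?thesis .
qed

lemma integral_sliced_X:
  fixes v :: "real^'n \<Rightarrow> real"
  assumes j: "j \<in> I" and v: "integrable (lebesgue_on X) v"
  shows "\<exists>F\<in>borel_measurable lborel. integrable lborel F \<and> (\<integral>x. v x \<partial>lebesgue_on X) = jac * (\<integral>t. F t \<partial>lborel)
     \<and> (AE t in lborel. (t \<in> Ycoord j \<longrightarrow> integrable (Mfib j) (\<lambda>z. indicator (Yfib j) z * v (Tf (ext j t z))))
           \<and> F t = indicator (Ycoord j) t * (\<integral>z. indicator (Yfib j) z * v (Tf (ext j t z)) \<partial>Mfib j))"
proof -
  let ?v = "\<lambda>y. indicator (Jf ` X) y * v (Tf y)"
  have "integrable lebesgue ?v" and e0: "(\<integral>x. v x \<partial>lebesgue_on X) = jac * (\<integral>y. ?v y \<partial>lebesgue)"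
    using linear_change.integral_transform[OF J_change X_meas v] by auto
  then obtain F where "F \<in> borel_measurable lborel" "integrable lborel F"
    and "(\<integral>y. ?v y \<partial>lebesgue) = (\<integral>t. F t \<partial>lborel)"
    and Fae: "AE t in lborel. integrable (Mfib j) (\<lambda>z. ?v (ext j t z)) \<and> F t = (\<integral>z. ?v (ext j t z) \<partial>Mfib j)"
    using integral_sliced[of ?v j] by blast
  moreover have "AE t in lborel. (t \<in> Ycoord j \<longrightarrow> integrable (Mfib j) (\<lambda>z. indicator (Yfib j) z * v (Tf (ext j t z))))
           \<and> F t = indicator (Ycoord j) t * (\<integral>z. indicator (Yfib j) z * v (Tf (ext j t z)) \<partial>Mfib j)"
    using Fae
  proof eventually_elim
    case (elim t)
    then show ?case by (cases "t \<in> Ycoord j") (simp_all add: indicator_JX_ext[OF j])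
  qed
  ultimately show ?thesis using e0 by auto
qed

lemma nn_integral_sliced_X:
  fixes v :: "real^'n \<Rightarrow> real"
  assumes j: "j \<in> I" and v: "v \<in> borel_measurable (lebesgue_on X)"
  shows "\<exists>W\<in>borel_measurable lborel. (\<integral>\<^sup>+x. ennreal (v x) \<partial>lebesgue_on X) = jac * (\<integral>\<^sup>+t. W t \<partial>lborel)
     \<and> (AE t in lborel. (t \<in> Ycoord j \<longrightarrow> (\<lambda>z. ennreal (indicator (Yfib j) z * v (Tf (ext j t z)))) \<in> borel_measurable (Mfib j))
           \<and> W t = (if t \<in> Ycoord j then (\<integral>\<^sup>+z. ennreal (indicator (Yfib j) z * v (Tf (ext j t z))) \<partial>Mfib j) else 0))"
proof -
  let ?v = "\<lambda>y. indicator (Jf ` X) y * v (Tf y)"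
  have "(\<lambda>y. ennreal (?v y)) \<in> borel_measurable lebesgue"
    using linear_change.transformed_measurable[OF J_change X_meas v] by simp
  then obtain W where "W \<in> borel_measurable lborel"
    and "(\<integral>\<^sup>+y. ennreal (?v y) \<partial>lebesgue) = (\<integral>\<^sup>+t. W t \<partial>lborel)"
    and Wae: "AE t in lborel. (\<lambda>z. ennreal (?v (ext j t z))) \<in> borel_measurable (Mfib j) \<and> W t = (\<integral>\<^sup>+z. ennreal (?v (ext j t z)) \<partial>Mfib j)"
    using nn_integral_sliced[of "\<lambda>y. ennreal (?v y)" j] by blast
  moreover have "AE t in lborel. (t \<in> Ycoord j \<longrightarrow> (\<lambda>z. ennreal (indicator (Yfib j) z * v (Tf (ext j t z)))) \<in> borel_measurable (Mfib j))
           \<and> W t = (if t \<in> Ycoord j then (\<integral>\<^sup>+z. ennreal (indicator (Yfib j) z * v (Tf (ext j t z))) \<partial>Mfib j) else 0)"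
    using Wae
  proof eventually_elim
    case (elim t)
    then show ?case by (cases "t \<in> Ycoord j") (simp_all add: indicator_JX_ext[OF j])
  qed
  ultimately show ?thesis
    using linear_change.nn_integral_transform[OF J_change X_meas v] by auto
qed

lemma component_pairing:
  assumes j: "j \<in> I" and gL2: "L2 X (\<lambda>x. w j x * g (a j \<bullet> x))"
  shows "\<exists>F\<in>borel_measurable lborel. integrable lborel F
     \<and> (\<integral>x. (f x - h x) * (w j x * g (a j \<bullet> x)) \<partial>lebesgue_on X) = jac * (\<integral>t. F t \<partial>lborel)
     \<and> (AE t in lborel. F t = indicator (Ycoord j) t * (g t * resid_moment j t))"
proof -
  obtain F where "F \<in> borel_measurable lborel" "integrable lborel F"
    "(\<integral>x. (f x - h x) * (w j x * g (a j \<bullet> x)) \<partial>lebesgue_on X) = jac * (\<integral>t. F t \<partial>lborel)"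
    and Fae: "AE t in lborel. F t = indicator (Ycoord j) t * (\<integral>z. indicator (Yfib j) z
        * ((f (Tf (ext j t z)) - h (Tf (ext j t z))) * (w j (Tf (ext j t z)) * g (a j \<bullet> Tf (ext j t z)))) \<partial>Mfib j)"
    using integral_sliced_X[OF j L2_mult[OF resid_L2 gL2]] by (auto elim: AE_mp)
  moreover have "AE t in lborel. F t = indicator (Ycoord j) t * (g t * resid_moment j t)"
    using Fae
  proof eventually_elim
    case (elim t)
    have "(\<lambda>z. indicator (Yfib j) z * ((f (Tf (ext j t z)) - h (Tf (ext j t z)))
            * (w j (Tf (ext j t z)) * g (a j \<bullet> Tf (ext j t z)))))
        = (\<lambda>z. g t * (indicator (Yfib j) z * ((f (Tf (ext j t z)) - h (Tf (ext j t z))) * w j (Tf (ext j t z)))))"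
      by (simp add: a_Tf_ext mult_ac)
    then show ?case using elim by (simp add: resid_moment_def)
  qed
  ultimately show ?thesis by blast
qed

lemma residual_orth_if_moment_zero:
  assumes j: "j \<in> I" and ae: "AE t in lborel. t \<in> Ycoord j \<longrightarrow> resid_moment j t = 0"
  shows "residual_orth j"
  unfolding residual_orth_def
proof (intro allI impI)
  fix g assume gL2: "L2 X (\<lambda>x. w j x * g (a j \<bullet> x))"
  obtain F where Fe: "(\<integral>x. (f x - h x) * (w j x * g (a j \<bullet> x)) \<partial>lebesgue_on X) = jac * (\<integral>t. F t \<partial>lborel)"
    and Fae: "AE t in lborel. F t = indicator (Ycoord j) t * (g t * resid_moment j t)"
    using component_pairing[OF j gL2] by blast
  have "AE t in lborel. F t = 0"
    using Fae ae by eventually_elim (auto simp: indicator_def)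
  then have "(\<integral>t. F t \<partial>lborel) = 0" by (rule integral_eq_zero_AE)
  then show "(\<integral>x. (f x - h x) * (w j x * g (a j \<bullet> x)) \<partial>lebesgue_on X) = 0"
    using Fe by simp
qed

lemma component_measurable:
  assumes j: "j \<in> I" and g: "g \<in> borel_measurable borel"
  shows "(\<lambda>x. w j x * g (a j \<bullet> x)) \<in> borel_measurable (lebesgue_on X)"
proof -
  have wm: "w j \<in> borel_measurable (lebesgue_on X)" using w_L2 j by (simp add: L2_def)
  have "(\<lambda>x. g (a j \<bullet> x)) \<in> borel_measurable lborel" using g by simp
  then have "(\<lambda>x. g (a j \<bullet> x)) \<in> borel_measurable (lebesgue_on X)"
    by (intro measurable_restrict_space1 measurable_completion)
  with wm show ?thesis by measurable
qed

lemma component_L2_if_weighted_finite: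
  assumes j: "j \<in> I" and g[measurable]: "g \<in> borel_measurable borel"
    and fin: "(\<integral>\<^sup>+t. indicator (Ycoord j) t * (ennreal ((g t)^2) * fibre_mass j t) \<partial>lborel) < \<infinity>"
  shows "L2 X (\<lambda>x. w j x * g (a j \<bullet> x))"
proof -
  have wm: "w j \<in> borel_measurable (lebesgue_on X)" using w_L2 j by (simp add: L2_def)
  have \<phi>m: "(\<lambda>x. w j x * g (a j \<bullet> x)) \<in> borel_measurable (lebesgue_on X)"
    by (rule component_measurable[OF j g])
  then have \<phi>2m: "(\<lambda>x. (w j x * g (a j \<bullet> x))^2) \<in> borel_measurable (lebesgue_on X)"
    by measurable
  have w2m: "(\<lambda>x. (w j x)^2) \<in> borel_measurable (lebesgue_on X)" using wm by measurable
  obtain W2 where W2e: "(\<integral>\<^sup>+x. ennreal ((w j x * g (a j \<bullet> x))^2) \<partial>lebesgue_on X) = jac * (\<integral>\<^sup>+t. W2 t \<partial>lborel)"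
    and W2ae: "AE t in lborel. W2 t = (if t \<in> Ycoord j then (\<integral>\<^sup>+z. ennreal (indicator (Yfib j) z
       * (w j (Tf (ext j t z)) * g (a j \<bullet> Tf (ext j t z)))^2) \<partial>Mfib j) else 0)"
    using nn_integral_sliced_X[OF j \<phi>2m] by (auto elim: AE_mp)
  obtain Wb where Wbae: "AE t in lborel. t \<in> Ycoord j
       \<longrightarrow> (\<lambda>z. ennreal (indicator (Yfib j) z * (w j (Tf (ext j t z)))^2)) \<in> borel_measurable (Mfib j)"
    using nn_integral_sliced_X[OF j w2m] by (auto elim: AE_mp)
  have "AE t in lborel. W2 t = indicator (Ycoord j) t * (ennreal ((g t)^2) * fibre_mass j t)"
    using W2ae Wbae
  proof eventually_elim
    case (elim t)
    show ?case
    proof (cases "t \<in> Ycoord j")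
      case True
      then have m: "(\<lambda>z. ennreal (indicator (Yfib j) z * (w j (Tf (ext j t z)))^2)) \<in> borel_measurable (Mfib j)"
        using elim by blast
      have "W2 t = (\<integral>\<^sup>+z. ennreal ((g t)^2) * ennreal (indicator (Yfib j) z * (w j (Tf (ext j t z)))^2) \<partial>Mfib j)"
        using elim True
        by (simp add: a_Tf_ext, intro nn_integral_cong)
          (simp add: ennreal_mult[symmetric] power_mult_distrib mult.commute mult.left_commute)
      also have "\<dots> = ennreal ((g t)^2) * fibre_mass j t"
        by (simp add: nn_integral_cmult[OF m] indicator_mult_ennreal ustar_Tf)
      finally show ?thesis using True by simp
    qed (use elim in simp)
  qed
  then have "(\<integral>\<^sup>+t. W2 t \<partial>lborel) < \<infinity>" using fin by (simp add: nn_integral_cong_AE)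
  then have "(\<integral>\<^sup>+x. ennreal ((w j x * g (a j \<bullet> x))^2) \<partial>lebesgue_on X) < \<infinity>"
    unfolding W2e by (simp add: ennreal_mult_less_top)
  then show ?thesis unfolding L2_def using \<phi>m integrableI_nonneg[OF \<phi>2m] by auto
qed

lemma truncation_admissible:
  assumes j: "j \<in> I"
    and FE[measurable]: "FE \<in> borel_measurable borel" and FEi: "integrable lborel FE"
    and Wb[measurable]: "Wb \<in> borel_measurable borel"
    and Wbae: "AE t in lborel. t \<in> Ycoord j \<longrightarrow> Wb t = fibre_mass j t"
  shows "L2 X (\<lambda>x. w j x * (FE (a j \<bullet> x) * indicator (level_set Wb FE n) (a j \<bullet> x)))"
proof (rule component_L2_if_weighted_finite[OF j])
  have [measurable]: "level_set Wb FE n \<in> sets borel" unfolding level_set_def by measurable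
  show "(\<lambda>t. FE t * indicator (level_set Wb FE n) t) \<in> borel_measurable borel" by measurable
  have "AE t in lborel. indicator (Ycoord j) t * (ennreal ((FE t * indicator (level_set Wb FE n) t)^2) * fibre_mass j t)
      \<le> ennreal (real n * real n * \<bar>FE t\<bar>)"
    using Wbae by eventually_elim
      (auto simp: indicator_def level_set_def intro!: truncation_weight_bound)
  then have "(\<integral>\<^sup>+t. indicator (Ycoord j) t * (ennreal ((FE t * indicator (level_set Wb FE n) t)^2) * fibre_mass j t) \<partial>lborel)
      \<le> (\<integral>\<^sup>+t. ennreal (real n * real n * \<bar>FE t\<bar>) \<partial>lborel)"
    by (rule nn_integral_mono_AE)
  also have "\<dots> < \<infinity>"
    using integrableD(2)[of lborel "\<lambda>t. real n * real n * \<bar>FE t\<bar>"] FEi by (simp add: abs_mult less_top)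
  finally show "(\<integral>\<^sup>+t. indicator (Ycoord j) t * (ennreal ((FE t * indicator (level_set Wb FE n) t)^2) * fibre_mass j t) \<partial>lborel) < \<infinity>" .
qed

text \<open>The truncation test: pairing the residual with the admissible truncation of FE gives the
  integral of FE^2 over the level set, so FE vanishes a.e. on every level set.\<close>
lemma resid_moment_zero_on_level_set:
  assumes j: "j \<in> I" and orth: "residual_orth j"
    and FE[measurable]: "FE \<in> borel_measurable borel" and FEi: "integrable lborel FE"
    and FEae: "AE t in lborel. FE t = indicator (Ycoord j) t * resid_moment j t"
    and Wb[measurable]: "Wb \<in> borel_measurable borel"
    and Wbae: "AE t in lborel. t \<in> Ycoord j \<longrightarrow> Wb t = fibre_mass j t"
  shows "AE t in lborel. t \<in> level_set Wb FE n \<longrightarrow> FE t = 0"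
proof -
  define gS where "gS t = FE t * indicator (level_set Wb FE n) t" for t
  have [measurable]: "level_set Wb FE n \<in> sets borel" unfolding level_set_def by measurable
  have gL2: "L2 X (\<lambda>x. w j x * gS (a j \<bullet> x))"
    unfolding gS_def by (rule truncation_admissible[OF j FE FEi Wb Wbae])
  obtain Fg where Fgm: "Fg \<in> borel_measurable lborel"
    and Fge: "(\<integral>x. (f x - h x) * (w j x * gS (a j \<bullet> x)) \<partial>lebesgue_on X) = jac * (\<integral>t. Fg t \<partial>lborel)"
    and Fgae: "AE t in lborel. Fg t = indicator (Ycoord j) t * (gS t * resid_moment j t)"
    using component_pairing[OF j gL2] by blast
  have "(\<integral>t. Fg t \<partial>lborel) = 0" using orth gL2 Fge jac_pos unfolding residual_orth_def by auto
  moreover have "AE t in lborel. Fg t = gS t * FE t"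
    using Fgae FEae by eventually_elim simp
  ultimately have int0: "(\<integral>t. gS t * FE t \<partial>lborel) = 0"
    using Fgm by (subst (asm) integral_cong_AE[of Fg lborel "\<lambda>t. gS t * FE t"]) (auto simp: gS_def)
  have iprod: "integrable lborel (\<lambda>t. gS t * FE t)"
  proof (rule Bochner_Integration.integrable_bound[of _ "\<lambda>t. real n * FE t"])
    show "integrable lborel (\<lambda>t. real n * FE t)" using FEi by auto
    have "\<bar>FE t\<bar> * \<bar>FE t\<bar> \<le> real n * \<bar>FE t\<bar>" if "t \<in> level_set Wb FE n" for t
      using that by (intro mult_right_mono) (auto simp: level_set_def)
    then show "AE t in lborel. norm (gS t * FE t) \<le> norm (real n * FE t)"
      by (intro AE_I2) (simp add: gS_def abs_mult indicator_def)
  qed (simp add: gS_def)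
  have "AE t in lborel. gS t * FE t = 0"
    using integral_nonneg_eq_0_iff_AE[OF iprod] int0 by (simp add: gS_def indicator_def)
  then show ?thesis
    by eventually_elim (auto simp: gS_def)
qed

text \<open>Step (3), hard direction: orthogonality forces the residual moment to vanish a.e. on
  Y_j, since every t with finite fibre mass lies in some level set.\<close>
lemma resid_moment_zero_if_orth:
  assumes j: "j \<in> I" and orth: "residual_orth j"
  shows "AE t in lborel. t \<in> Ycoord j \<longrightarrow> resid_moment j t = 0"
proof -
  have wL2: "L2 X (w j)" using w_L2 j by blast
  obtain FE where FEm: "FE \<in> borel_measurable lborel" and FEi: "integrable lborel FE"
    and FEae0: "AE t in lborel. FE t = indicator (Ycoord j) t * (\<integral>z. indicator (Yfib j) z
        * ((f (Tf (ext j t z)) - h (Tf (ext j t z))) * w j (Tf (ext j t z))) \<partial>Mfib j)"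
    using integral_sliced_X[OF j L2_mult[OF resid_L2 wL2]] by (auto elim: AE_mp)
  have FEae: "AE t in lborel. FE t = indicator (Ycoord j) t * resid_moment j t"
    using FEae0 by (simp add: resid_moment_def)
  have "w j \<in> borel_measurable (lebesgue_on X)" using wL2 by (simp add: L2_def)
  then have "(\<lambda>x. (w j x)^2) \<in> borel_measurable (lebesgue_on X)" by measurable
  then obtain Wb where Wbm: "Wb \<in> borel_measurable lborel"
    and Wbae0: "AE t in lborel. Wb t = (if t \<in> Ycoord j
       then (\<integral>\<^sup>+z. ennreal (indicator (Yfib j) z * (w j (Tf (ext j t z)))^2) \<partial>Mfib j) else 0)"
    using nn_integral_sliced_X[OF j] by (auto elim: AE_mp)
  have Wbae: "AE t in lborel. t \<in> Ycoord j \<longrightarrow> Wb t = fibre_mass j t"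
    using Wbae0 by eventually_elim (simp add: indicator_mult_ennreal ustar_Tf)
  have "AE t in lborel. \<forall>n. t \<in> level_set Wb FE n \<longrightarrow> FE t = 0"
    unfolding AE_all_countable
    using resid_moment_zero_on_level_set[OF j orth _ FEi FEae _ Wbae] FEm Wbm by simp
  moreover have "AE t in lborel. t \<in> Ycoord j \<longrightarrow> fibre_mass j t < \<infinity>"
    using W_pos j by (auto elim: AE_mp)
  ultimately show ?thesis
    using FEae Wbae
  proof eventually_elim
    case (elim t)
    then show ?case
      using level_set_exhaust[of Wb t FE] by auto
  qed
qed

lemma resid_moment_split:
  assumes j: "j \<in> I"
    and iA: "integrable (Mfib j) (\<lambda>z. indicator (Yfib j) z * ((f (Tf (ext j t z))
       - (\<Sum>i\<in>I - {j}. w i (Tf (ext j t z)) * g0 i (a i \<bullet> Tf (ext j t z)))) * w j (Tf (ext j t z))))"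
      (is "integrable _ ?A")
    and iB: "integrable (Mfib j) (\<lambda>z. indicator (Yfib j) z * (w j (Tf (ext j t z)))^2)"
      (is "integrable _ ?B")
  shows "fibre_mass j t = ennreal (\<integral>z. ?B z \<partial>Mfib j)"
    and "resid_moment j t = fibre_moment j t - g0 j t * enn2real (fibre_mass j t)"
proof -
  have "fibre_mass j t = (\<integral>\<^sup>+ z. ennreal (?B z) \<partial>Mfib j)"
    by (simp add: indicator_mult_ennreal ustar_Tf)
  also have "\<dots> = ennreal (\<integral>z. ?B z \<partial>Mfib j)"
    by (rule nn_integral_eq_integral[OF iB]) simp
  finally show mass: "fibre_mass j t = ennreal (\<integral>z. ?B z \<partial>Mfib j)" .
  have "fibre_moment j t = (\<integral>z. ?A z \<partial>Mfib j)"
    by (rule Bochner_Integration.integral_cong) (auto simp: ustar_Tf a_Tf)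
  moreover have "h (Tf (ext j t z)) = (\<Sum>i\<in>I - {j}. w i (Tf (ext j t z)) * g0 i (a i \<bullet> Tf (ext j t z)))
      + w j (Tf (ext j t z)) * g0 j t" for z
    unfolding h_def using j by (simp add: sum.remove[of I j] a_Tf_ext)
  then have "resid_moment j t = (\<integral>z. ?A z - g0 j t * ?B z \<partial>Mfib j)"
    unfolding resid_moment_def
    by (intro Bochner_Integration.integral_cong) (auto simp: algebra_simps power2_eq_square)
  moreover have "\<dots> = (\<integral>z. ?A z \<partial>Mfib j) - g0 j t * (\<integral>z. ?B z \<partial>Mfib j)"
    using iA iB by simp
  ultimately show "resid_moment j t = fibre_moment j t - g0 j t * enn2real (fibre_mass j t)"
    using mass by (simp add: integral_nonneg_AE)
qed

lemma resid_moment_normal_form: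
  assumes j: "j \<in> I"
  shows "AE t in lborel. t \<in> Ycoord j \<longrightarrow> 0 < enn2real (fibre_mass j t)
           \<and> resid_moment j t = fibre_moment j t - g0 j t * enn2real (fibre_mass j t)"
proof -
  have wL2: "L2 X (w j)" using w_L2 j by blast
  let ?r = "\<lambda>x. \<Sum>i\<in>I - {j}. w i x * g0 i (a i \<bullet> x)"
  have rL2: "L2 X ?r" by (rule L2_sum) (use g0_L2 in auto)
  have "integrable (lebesgue_on X) (\<lambda>x. (f x - ?r x) * w j x)"
    by (rule L2_mult[OF L2_diff[OF f_L2 rL2] wL2])
  from integral_sliced_X[OF j this] have iA: "AE t in lborel. t \<in> Ycoord j \<longrightarrow>
      integrable (Mfib j) (\<lambda>z. indicator (Yfib j) z * ((f (Tf (ext j t z)) - ?r (Tf (ext j t z))) * w j (Tf (ext j t z))))"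
    by (auto elim: AE_mp)
  have "integrable (lebesgue_on X) (\<lambda>x. (w j x)^2)" using wL2 by (simp add: L2_def)
  from integral_sliced_X[OF j this] have iB: "AE t in lborel. t \<in> Ycoord j \<longrightarrow>
      integrable (Mfib j) (\<lambda>z. indicator (Yfib j) z * (w j (Tf (ext j t z)))^2)"
    by (auto elim: AE_mp)
  have "AE t in lborel. t \<in> Ycoord j \<longrightarrow> 0 < fibre_mass j t \<and> fibre_mass j t < \<infinity>"
    using W_pos j by (auto elim: AE_mp)
  then show ?thesis
    using iA iB by eventually_elim (auto simp: resid_moment_split[OF j] enn2real_positive_iff)
qed

lemma residual_orth_iff_normal_equation:
  assumes j: "j \<in> I"
  shows "residual_orth j \<longleftrightarrow>
    (AE t in lborel. t \<in> Ycoord j \<longrightarrow> g0 j t = 1 / enn2real (fibre_mass j t) * fibre_moment j t)"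
proof -
  have "residual_orth j \<longleftrightarrow> (AE t in lborel. t \<in> Ycoord j \<longrightarrow> resid_moment j t = 0)"
    using residual_orth_if_moment_zero[OF j] resid_moment_zero_if_orth[OF j] by blast
  also have "\<dots> \<longleftrightarrow> (AE t in lborel. t \<in> Ycoord j \<longrightarrow> g0 j t = 1 / enn2real (fibre_mass j t) * fibre_moment j t)"
    using resid_moment_normal_form[OF j]
    by (intro AE_cong_simp iffI) (auto elim: AE_mp simp: field_simps)
  finally show ?thesis .
qed

lemma best_approx_iff_normal_equations:
  "best_approx X (ridge_set X I a w) f h \<longleftrightarrow>
    (\<forall>j\<in>I. AE t in lborel. t \<in> Ycoord j \<longrightarrow> g0 j t = 1 / enn2real (fibre_mass j t) * fibre_moment j t)"
  using best_approx_iff_residual_orth residual_orth_iff_normal_equation by simp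

end

text \<open>Theorem 2.4.\<close>
theorem theorem2p4:
  fixes X :: "(real^'n) set" and I :: "'n set" and a :: "'n \<Rightarrow> real^'n"
    and w :: "'n \<Rightarrow> real^'n \<Rightarrow> real" and f :: "real^'n \<Rightarrow> real"
    and g0 :: "'n \<Rightarrow> real \<Rightarrow> real" and Y0 :: "('n \<Rightarrow> real) set"
  assumes X_meas: "X \<in> sets lebesgue" and X_fin: "emeasure lebesgue X < \<infinity>"
    and basis: "invertible (Jmat a)"
    and w_L2: "\<forall>i\<in>I. L2 X (w i)"
    and Y0_meas: "Y0 \<in> sets (completion (PiM (- I) (\<lambda>_. lborel)))"
    and rset: "(\<lambda>x. Jmat a *v x) ` X =
       {y. (\<forall>i\<in>I. y $ i \<in> proj_set X a i) \<and> restrict (\<lambda>k. y $ k) (- I) \<in> Y0}"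
    and f_L2: "L2 X f"
    and g0_L2: "\<forall>i\<in>I. L2 X (\<lambda>x. w i x * g0 i (a i \<bullet> x))"
    and W_pos: "\<forall>j\<in>I. AE t in lborel. t \<in> proj_set X a j \<longrightarrow>
       0 < (\<integral>\<^sup>+ z. indicator (fibre_set I (proj_set X a) Y0 j) z
                  * ennreal ((ustar a (w j) (ext j t z))^2) \<partial>Mfib j)
     \<and> (\<integral>\<^sup>+ z. indicator (fibre_set I (proj_set X a) Y0 j) z
                  * ennreal ((ustar a (w j) (ext j t z))^2) \<partial>Mfib j) < \<infinity>"
  shows "best_approx X (ridge_set X I a w) f (\<lambda>x. \<Sum>i\<in>I. w i x * g0 i (a i \<bullet> x)) \<longleftrightarrow>
    (\<forall>j\<in>I. AE t in lborel. t \<in> proj_set X a j \<longrightarrow>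
       g0 j t = (1 / enn2real (\<integral>\<^sup>+ z. indicator (fibre_set I (proj_set X a) Y0 j) z
                  * ennreal ((ustar a (w j) (ext j t z))^2) \<partial>Mfib j))
         * (\<integral> z. indicator (fibre_set I (proj_set X a) Y0 j) z
              * (ustar a f (ext j t z)
                 - (\<Sum>i\<in>I - {j}. ustar a (w i) (ext j t z) * g0 i (ext j t z $ i)))
              * ustar a (w j) (ext j t z) \<partial>Mfib j))"
proof -
  interpret ridge_problem X I a w f g0 Y0
    by unfold_locales (use X_meas basis w_L2 rset f_L2 g0_L2 W_pos in auto)
  show ?thesis using best_approx_iff_normal_equations unfolding h_def .
qed

end
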